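(* Let $\alpha>0$ and $0<\gamma<1$. If $A\in\mathcal{HSD}$, i.e. $A\subseteq\mathbb{N}$ and $\sum_{n\in A}\frac1n=\infty$, then $g_{\alpha,\gamma}[A]\in\mathcal{HSD}$, i.e. $\sum_{m\in g_{\alpha,\gamma}[A]}\frac1m=\infty$. In other words, $g_{\alpha,\gamma}[\mathcal{HSD}]\subseteq\mathcal{HSD}$.
   Context: $\mathbb{N}=\{1,2,3,\dots\}$. For $\alpha>0$ and $0<\gamma<1$, $g_{\alpha,\gamma}(n)=\lfloor \alpha n+\gamma\rfloor$ for $n\in\mathbb{N}$; for $A\subseteq\mathbb{N}$, $g_{\alpha,\gamma}[A]=\{g_{\alpha,\gamma}(n):n\in A\}\cap\mathbb{N}$ (a value $0$, which can occur for finitely many $n$ when $\alpha$ is small, is discarded). $\mathcal{HSD}=\{A\subseteq\mathbb{N}:\sum_{n\in A}\frac1n=\infty\}$. For a collection $\mathcal{F}$ of subsets of $\mathbb{N}$, $g_{\alpha,\gamma}[\mathcal{F}]=\{g_{\alpha,\gamma}[A]:A\in\mathcal{F}\}$. *)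

theory Defs
  imports "HOL-Analysis.Analysis"
begin

definition PosN :: "nat set" where
  "PosN = {1..}"

text \<open>For the parameters of interest (\<open>\<alpha> > 0\<close>, \<open>0 < \<gamma> < 1\<close>) the argument of the floor is
  positive, so the conversion \<^const>\<open>nat\<close> loses nothing.\<close>

definition beatty :: "real \<Rightarrow> real \<Rightarrow> nat \<Rightarrow> nat" where
  "beatty \<alpha> \<gamma> n = nat \<lfloor>\<alpha> * real n + \<gamma>\<rfloor>"

text \<open>The intersection discards the value 0, which occurs for small \<open>n\<close> when \<open>\<alpha>\<close> is small.\<close>

definition beatty_set :: "real \<Rightarrow> real \<Rightarrow> nat set \<Rightarrow> nat set" where
  "beatty_set \<alpha> \<gamma> A = beatty \<alpha> \<gamma> ` A \<inter> PosN"

definition beatty_family :: "real \<Rightarrow> real \<Rightarrow> nat set set \<Rightarrow> nat set set" where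
  "beatty_family \<alpha> \<gamma> \<F> = {beatty_set \<alpha> \<gamma> A | A. A \<in> \<F>}"

text \<open>The sum is taken in \<^typ>\<open>ennreal\<close>, where every sum of nonnegative terms exists, so that
  being equal to \<open>\<infinity>\<close> means exactly divergence.\<close>

definition HSD :: "nat set set" where
  "HSD = {A. A \<subseteq> PosN \<and> (\<Sum>\<^sub>\<infinity>n\<in>A. ennreal (1 / real n)) = \<infinity>}"

end

theory Submission
  imports Defs
begin

text \<open>
  The map \<open>n \<mapsto> \<lfloor>\<alpha> n + \<gamma>\<rfloor>\<close> distorts harmonic sums by at most a constant factor, for two reasons.
  Consecutive values of \<open>\<alpha> n + \<gamma>\<close> are \<open>\<alpha>\<close> apart, so at most \<open>\<lfloor>1/\<alpha>\<rfloor> + 1\<close> integers share one value of the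
  floor (\<open>card_beatty_fibre_le\<close>). And a positive value \<open>m\<close> satisfies \<open>m \<le> \<alpha> n + \<gamma> \<le> (\<alpha> + 1) n\<close>, so
  that \<open>1/n \<le> (\<alpha> + 1)/m\<close> (\<open>inverse_le_inverse_beatty\<close>). Grouping a harmonic sum over \<open>A\<close> by the
  values of the map therefore bounds it by a constant multiple of \<open>1 + S\<close>, where \<open>S\<close> is the harmonic
  sum over the image of \<open>A\<close> and the \<open>1\<close> pays for the discarded value \<open>0\<close>. Since all finite partial sums
  over \<open>A\<close> obey this bound, \<open>S\<close> is infinite whenever the sum over \<open>A\<close> is.
\<close>

lemma beatty_bounds:
  assumes "\<alpha> > 0" "\<gamma> > 0"
  shows "real (beatty \<alpha> \<gamma> n) \<le> \<alpha> * real n + \<gamma>" "\<alpha> * real n + \<gamma> < real (beatty \<alpha> \<gamma> n) + 1"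
proof -
  have "0 \<le> \<alpha> * real n + \<gamma>" using assms by simp
  then have "real (beatty \<alpha> \<gamma> n) = of_int \<lfloor>\<alpha> * real n + \<gamma>\<rfloor>"
    unfolding beatty_def by simp
  then show "real (beatty \<alpha> \<gamma> n) \<le> \<alpha> * real n + \<gamma>" "\<alpha> * real n + \<gamma> < real (beatty \<alpha> \<gamma> n) + 1"
    by linarith+
qed

text \<open>
  Measured from the least element \<open>n\<^sub>0\<close> of the fibre, every other element \<open>n\<close> satisfies
  \<open>\<alpha> (n - n\<^sub>0) < 1\<close>, because both values of \<open>\<alpha> n + \<gamma>\<close> lie in the same unit interval.
\<close>

lemma card_beatty_fibre_le:
  assumes "\<alpha> > 0" "\<gamma> > 0"
  shows "card {n \<in> F. beatty \<alpha> \<gamma> n = m} \<le> nat \<lfloor>1 / \<alpha>\<rfloor> + 1"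
proof (cases "{n \<in> F. beatty \<alpha> \<gamma> n = m} = {}")
  case True
  then show ?thesis by (metis card.empty le0)
next
  case False
  define n0 where "n0 = (LEAST n. n \<in> F \<and> beatty \<alpha> \<gamma> n = m)"
  from False have "\<exists>n. n \<in> F \<and> beatty \<alpha> \<gamma> n = m" by simp
  then have n0: "n0 \<in> F \<and> beatty \<alpha> \<gamma> n0 = m"
    unfolding n0_def by (rule LeastI_ex)
  have "{n \<in> F. beatty \<alpha> \<gamma> n = m} \<subseteq> {n0..n0 + nat \<lfloor>1 / \<alpha>\<rfloor>}"
  proof
    fix n assume "n \<in> {n \<in> F. beatty \<alpha> \<gamma> n = m}"
    then have n: "n \<in> F \<and> beatty \<alpha> \<gamma> n = m" by simp
    then have le: "n0 \<le> n" unfolding n0_def by (rule Least_le)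
    have "\<alpha> * (real n - real n0) < 1"
      using beatty_bounds[OF assms, of n] beatty_bounds[OF assms, of n0] n n0
      by (simp add: right_diff_distrib)
    then have "real (n - n0) < 1 / \<alpha>"
      using assms(1) le by (simp add: field_simps of_nat_diff)
    then have "n - n0 \<le> nat \<lfloor>1 / \<alpha>\<rfloor>" by (simp add: le_nat_floor)
    with le show "n \<in> {n0..n0 + nat \<lfloor>1 / \<alpha>\<rfloor>}" by simp
  qed
  from card_mono[OF _ this] show ?thesis by simp
qed

lemma inverse_le_inverse_beatty:
  assumes "\<alpha> > 0" "0 < \<gamma>" "\<gamma> < 1" "beatty \<alpha> \<gamma> n > 0"
  shows "1 / real n \<le> (\<alpha> + 1) * (1 / real (beatty \<alpha> \<gamma> n))"
proof (cases "n = 0")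
  case True
  then show ?thesis using assms by simp
next
  case False
  have "real (beatty \<alpha> \<gamma> n) \<le> \<alpha> * real n + 1 * real n"
    using beatty_bounds(1)[OF assms(1,2), of n] assms(3) False by linarith
  then show ?thesis using False assms by (simp add: field_simps)
qed

lemma sum_le_card_fibre_times_sum_image:
  fixes f h :: "_ \<Rightarrow> ennreal"
  assumes "finite F"
    and card: "\<And>m. card {n \<in> F. g n = m} \<le> C"
    and le: "\<And>n. n \<in> F \<Longrightarrow> f n \<le> h (g n)"
  shows "sum f F \<le> of_nat C * sum h (g ` F)"
proof -
  have "sum f F = (\<Sum>m\<in>g ` F. sum f {n \<in> F. g n = m})"
    by (rule sum.image_gen[OF assms(1)])
  also have "\<dots> \<le> (\<Sum>m\<in>g ` F. of_nat C * h m)"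
  proof (rule sum_mono)
    fix m
    have "sum f {n \<in> F. g n = m} \<le> of_nat (card {n \<in> F. g n = m}) * h m"
      by (rule sum_bounded_above) (use le in auto)
    also have "\<dots> \<le> of_nat C * h m"
      by (intro mult_right_mono) (use card in auto)
    finally show "sum f {n \<in> F. g n = m} \<le> of_nat C * h m" .
  qed
  finally show ?thesis by (simp add: sum_distrib_left)
qed

lemma infsum_inverse_le_infsum_inverse_beatty_set:
  assumes "\<alpha> > 0" "0 < \<gamma>" "\<gamma> < 1"
  shows "(\<Sum>\<^sub>\<infinity>n\<in>A. ennreal (1 / real n)) \<le> of_nat (nat \<lfloor>1 / \<alpha>\<rfloor> + 1) *
    (1 + ennreal (\<alpha> + 1) * (\<Sum>\<^sub>\<infinity>m\<in>beatty_set \<alpha> \<gamma> A. ennreal (1 / real m)))"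
    (is "_ \<le> of_nat ?C * (1 + _ * ?S)")
proof (rule infsum_le_finite_sums)
  show "(\<lambda>n. ennreal (1 / real n)) summable_on A"
    by (rule nonneg_summable_on_complete) simp
next
  fix F assume F: "finite F" "F \<subseteq> A"
  let ?g = "beatty \<alpha> \<gamma>"
  \<comment> \<open>On the fibre over \<open>0\<close> no multiple of \<open>1/m\<close> is available; there \<open>1/n \<le> 1\<close> suffices.\<close>
  define h where
    "h m = (if m = 0 then 1 else ennreal (\<alpha> + 1) * ennreal (1 / real m))" for m :: nat
  have term_le: "ennreal (1 / real n) \<le> h (?g n)" for n
  proof (cases "?g n = 0")
    case True
    have "1 / real n \<le> 1" by (cases n) auto
    then show ?thesis using True by (simp add: h_def ennreal_le_1)
  next
    case False
    then have "ennreal (1 / real n) \<le> ennreal ((\<alpha> + 1) * (1 / real (?g n)))"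
      by (intro ennreal_leI inverse_le_inverse_beatty assms) simp
    also have "\<dots> = ennreal (\<alpha> + 1) * ennreal (1 / real (?g n))"
      using assms by (intro ennreal_mult) auto
    finally show ?thesis using False by (simp add: h_def)
  qed
  have "sum h (?g ` F) \<le> sum h (insert 0 (?g ` F \<inter> PosN))"
    using F(1) by (intro sum_mono2) (auto simp: PosN_def)
  also have "\<dots> = 1 + sum h (?g ` F \<inter> PosN)"
    using F(1) by (subst sum.insert) (auto simp: PosN_def h_def)
  also have "sum h (?g ` F \<inter> PosN) = ennreal (\<alpha> + 1) * (\<Sum>m\<in>?g ` F \<inter> PosN. ennreal (1 / real m))"
    unfolding sum_distrib_left by (rule sum.cong) (auto simp: PosN_def h_def)
  also have "(\<Sum>m\<in>?g ` F \<inter> PosN. ennreal (1 / real m)) \<le> ?S"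
    unfolding infsum_finite[OF finite_Int[OF disjI1[OF finite_imageI[OF F(1)]]], symmetric]
    by (rule infsum_mono_neutral)
      (use F(2) in \<open>auto simp: beatty_set_def intro!: nonneg_summable_on_complete\<close>)
  finally have "sum h (?g ` F) \<le> 1 + ennreal (\<alpha> + 1) * ?S"
    by (simp add: add_left_mono mult_left_mono)
  moreover have "(\<Sum>n\<in>F. ennreal (1 / real n)) \<le> of_nat ?C * sum h (?g ` F)"
    by (rule sum_le_card_fibre_times_sum_image)
      (use F(1) card_beatty_fibre_le[OF assms(1,2)] term_le in auto)
  ultimately show "(\<Sum>n\<in>F. ennreal (1 / real n)) \<le> of_nat ?C * (1 + ennreal (\<alpha> + 1) * ?S)"
    by (meson mult_left_mono order_trans zero_le)
qed

theorem theorem2p2: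
  fixes \<alpha> \<gamma> :: real
  assumes "\<alpha> > 0" and "0 < \<gamma>" and "\<gamma> < 1"
  shows "(\<forall>A. A \<in> HSD \<longrightarrow> beatty_set \<alpha> \<gamma> A \<in> HSD) \<and> beatty_family \<alpha> \<gamma> HSD \<subseteq> HSD"
proof -
  have "beatty_set \<alpha> \<gamma> A \<in> HSD" if "A \<in> HSD" for A
  proof -
    let ?S = "\<Sum>\<^sub>\<infinity>m\<in>beatty_set \<alpha> \<gamma> A. ennreal (1 / real m)"
    have "of_nat (nat \<lfloor>1 / \<alpha>\<rfloor> + 1) * (1 + ennreal (\<alpha> + 1) * ?S) = \<infinity>"
      using infsum_inverse_le_infsum_inverse_beatty_set[OF assms, of A] that
      by (simp add: HSD_def top_unique)
    then have "?S = \<infinity>"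
      by (auto simp: ennreal_mult_eq_top_iff simp del: of_nat_add of_nat_Suc)
    then show ?thesis by (auto simp: HSD_def beatty_set_def)
  qed
  then show ?thesis by (auto simp: beatty_family_def)
qed

end
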